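(* Let $p\ge 2$, let $X_1,\dots,X_n$ be a random sample (i.i.d.) from a known continuous distribution $F$ on $\mathbb{R}^p$, and let $D$ be a data depth. For an index $r_n\in\{1,\dots,n\}$, consider the tolerance region $$O_{Z^{[r_n]}}=\bigcup_{i=1}^{r_n}MS_i\equiv\{x\in\mathbb{R}^p: D_F(x)>Z^{[r_n]}\}.$$ Then the distribution of $P_F(O_{Z^{[r_n]}})$, the coverage probability of this tolerance region, is the Beta distribution $Beta(r_n,\,n+1-r_n)$.
   Context: A data depth $D$ assigns to each distribution $F$ on $\mathbb{R}^p$ a function $D_F:\mathbb{R}^p\to[0,\infty)$, where $D_F(x)$ measures how deep (central) $x$ is with respect to $F$. $P_F$ denotes probability under $F$. Put $Z_i=D_F(X_i)$ and let $Z^{[1]}\ge\dots\ge Z^{[n]}$ be the $Z_i$ in descending order; set $Z^{[0]}=\sup_x D_F(x)$ and $Z^{[n+1]}=0$. The multivariate spacings are $MS_i=\{x: Z^{[i-1]}\ge D_F(x)>Z^{[i]}\}$, $i=1,\dots,n+1$. The region $O_{Z^{[r_n]}}$ is random (a function of the sample), and $P_F(O_{Z^{[r_n]}})$ is its $F$-measure given the sample.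
   Formalization: It is additionally assumed that D_F is Borel measurable and that D_F(X), X~F, has a continuous (atomless) distribution; without the latter the claim fails, e.g. for constant D_F the region is empty and its coverage is 0. *)

theory Defs
  imports "HOL-Probability.Probability"
begin

text \<open>A depth is a family of functions, one for each Borel probability distribution on
  \<open>\<real>\<^sup>p\<close>, with finite nonnegative values.\<close>

definition data_depth :: "((real^'p) measure \<Rightarrow> real^'p \<Rightarrow> real) \<Rightarrow> bool" where
  "data_depth D \<longleftrightarrow>
     (\<forall>F. prob_space F \<and> sets F = sets borel \<longrightarrow> (\<forall>x. 0 \<le> D F x))"

text \<open>Continuity means absence of atoms. On the real line this is continuity of the distribution
  function; on \<open>\<real>\<^sup>p\<close> it is implied by continuity of the joint distribution function and by the
  existence of a density.\<close>

definition continuous_distribution :: "'a measure \<Rightarrow> bool" where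
  "continuous_distribution F \<longleftrightarrow> (\<forall>x. measure F {x} = 0)"

text \<open>For a depth function \<open>d\<close> and sample points \<open>x 1, \<dots>, x n\<close>, \<open>depth_order_stat d n x i\<close> is
  \<open>Z\<^sup>[\<^sup>i\<^sup>]\<close>, the \<open>i\<close>-th largest of \<open>d (x 1), \<dots>, d (x n)\<close> for \<open>1 \<le> i \<le> n\<close>. The values are extended
  reals because the supremum \<open>Z\<^sup>[\<^sup>0\<^sup>]\<close> of an unbounded depth function is infinite.\<close>

definition depth_order_stat :: "('b \<Rightarrow> real) \<Rightarrow> nat \<Rightarrow> (nat \<Rightarrow> 'b) \<Rightarrow> nat \<Rightarrow> ereal" where
  "depth_order_stat d n x i =
     (if i = 0 then (SUP y. ereal (d y))
      else if i \<le> n then ereal (rev (sort (map (\<lambda>j. d (x j)) [1..<n+1])) ! (i - 1))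
      else 0)"

definition multivariate_spacing :: "('b \<Rightarrow> real) \<Rightarrow> nat \<Rightarrow> (nat \<Rightarrow> 'b) \<Rightarrow> nat \<Rightarrow> 'b set" where
  "multivariate_spacing d n x i =
     {y. depth_order_stat d n x (i - 1) \<ge> ereal (d y) \<and> ereal (d y) > depth_order_stat d n x i}"

definition tolerance_region :: "('b \<Rightarrow> real) \<Rightarrow> nat \<Rightarrow> (nat \<Rightarrow> 'b) \<Rightarrow> nat \<Rightarrow> 'b set" where
  "tolerance_region d n x r = (\<Union>i\<in>{1..r}. multivariate_spacing d n x i)"

definition beta_density :: "real \<Rightarrow> real \<Rightarrow> real \<Rightarrow> real" where
  "beta_density a b x =
     (if 0 < x \<and> x < 1 then x powr (a - 1) * (1 - x) powr (b - 1) / Beta a b else 0)"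

end

theory Submission
  imports Defs
begin

text \<open>Let \<open>G t\<close> be the \<open>F\<close>-measure of the set where the depth exceeds \<open>t\<close>. Since the depth has an
  atomless law, the \<open>G (D F (X i))\<close> are i.i.d. uniform, and since \<open>G\<close> is antitone, the coverage
  \<open>G (Z\<^sup>[\<^sup>r\<^sup>])\<close> is their \<open>r\<close>-th smallest value. It is at most \<open>a\<close> iff at least \<open>r\<close> of the uniforms are,
  which has the probability of a binomial tail with success probability \<open>a\<close>.\<close>

section \<open>Order statistics and the tolerance region as a superlevel set\<close>

text \<open>An upward closed \<open>P\<close> holds on an initial segment of the descending list,
  and sorting leaves the number of entries satisfying \<open>P\<close> unchanged. Positions start at
  0, so position \<open>k\<close> lies in that segment iff the segment has more than
  \<open>k\<close> entries.\<close>

lemma nth_rev_sort_iff_filter: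
  fixes xs :: "'a::linorder list"
  assumes up: "\<And>a b. a \<le> b \<Longrightarrow> P a \<Longrightarrow> P b" and k: "k < length xs"
  shows "P (rev (sort xs) ! k) \<longleftrightarrow> k < length (filter P xs)"
proof -
  let ?ys = "rev (sort xs)"
  have "mset (filter P xs) = mset (filter P ?ys)"
    by simp
  then have "length (filter P xs) = length (filter P ?ys)"
    by (rule mset_eq_length)
  also have "\<dots> = card {i. i < length xs \<and> P (?ys ! i)}"
    by (simp add: length_filter_conv_card)
  finally have len: "length (filter P xs) = card {i. i < length xs \<and> P (?ys ! i)}" .
  have mono: "?ys ! j \<le> ?ys ! i" if "i \<le> j" "j < length xs" for i j
    using that by (intro sorted_rev_nth_mono) auto
  show ?thesis
  proof (cases "P (?ys ! k)")
    case True
    have "{..k} \<subseteq> {i. i < length xs \<and> P (?ys ! i)}"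
      using mono[of _ k] k True up by auto
    from card_mono[OF _ this] show ?thesis
      using True len by simp
  next
    case False
    have "{i. i < length xs \<and> P (?ys ! i)} \<subseteq> {..<k}"
      using mono[of k] False up by (metis (mono_tags, lifting) lessThan_iff linorder_not_less mem_Collect_eq subsetI)
    from card_mono[OF _ this] show ?thesis
      using False len by simp
  qed
qed

lemma filter_map_upt_length:
  "length (filter P (map f [1..<n+1])) = card {i\<in>{1..n}. P (f i)}"
proof -
  have "length (filter P (map f [1..<n+1])) = card (set (filter (P \<circ> f) [1..<n+1]))"
    by (subst distinct_card) (auto simp: filter_map)
  also have "set (filter (P \<circ> f) [1..<n+1]) = {i\<in>{1..n}. P (f i)}"
    by auto
  finally show ?thesis .
qed

lemma depth_order_stat_antimono:
  assumes "i \<le> j" "j \<le> n"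
  shows "depth_order_stat d n x j \<le> depth_order_stat d n x i"
proof (cases "i = 0")
  \<comment> \<open>Index 0 is not a list position: its value is the supremum, which dominates every
    sample depth.\<close>
  case True
  let ?xs = "rev (sort (map (\<lambda>j. d (x j)) [1..<n+1]))"
  show ?thesis
  proof (cases "j = 0")
    case False
    then have "?xs ! (j - 1) \<in> set ?xs"
      using assms by (intro nth_mem) (simp del: upt_Suc)
    then obtain y where "?xs ! (j - 1) = d y"
      by (auto simp del: upt_Suc)
    then show ?thesis
      using True False assms by (auto simp: depth_order_stat_def intro: SUP_upper)
  qed (simp add: True)
next
  case False
  then show ?thesis
    using assms by (auto simp: depth_order_stat_def intro!: sorted_rev_nth_mono simp del: upt_Suc)
qed

text \<open>The spacings are consecutive shells between descending levels, so their union
  telescopes. A point above the \<open>r\<close>-th level lies in the shell of the first index whose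
  level it exceeds; that index is not 0, because nothing exceeds the supremum.\<close>

lemma tolerance_region_eq:
  assumes r: "r \<in> {1..n}"
  shows "tolerance_region d n x r = {y. ereal (d y) > depth_order_stat d n x r}"
proof (intro equalityI subsetI)
  fix y assume "y \<in> tolerance_region d n x r"
  then obtain i where "i \<in> {1..r}" "depth_order_stat d n x i < ereal (d y)"
    by (auto simp: tolerance_region_def multivariate_spacing_def)
  then show "y \<in> {y. ereal (d y) > depth_order_stat d n x r}"
    using depth_order_stat_antimono[of i r n d x] r by auto
next
  fix y assume "y \<in> {y. ereal (d y) > depth_order_stat d n x r}"
  then have yr: "depth_order_stat d n x r < ereal (d y)" by simp
  define i where "i = (LEAST i. depth_order_stat d n x i < ereal (d y))"
  have i: "depth_order_stat d n x i < ereal (d y)" "i \<le> r"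
    unfolding i_def using yr by (rule LeastI, rule Least_le)
  have "ereal (d y) \<le> depth_order_stat d n x 0"
    by (auto simp: depth_order_stat_def intro: SUP_upper)
  then have "i \<noteq> 0"
    using i(1) by (cases "i = 0") auto
  then have "\<not> depth_order_stat d n x (i - 1) < ereal (d y)"
    unfolding i_def by (intro not_less_Least) simp
  then have "y \<in> multivariate_spacing d n x i"
    using i by (simp add: multivariate_spacing_def not_less)
  then show "y \<in> tolerance_region d n x r"
    using i \<open>i \<noteq> 0\<close> by (auto simp: tolerance_region_def)
qed

section \<open>The probability integral transform\<close>

text \<open>For a level strictly between 0 and 1 the set is a half-line whose endpoint is a
  quantile, and without atoms the cdf attains the required value exactly there, even if it has flat
  stretches. Levels 0 and 1 are separate because the generalised inverse is used only inside the
  unit interval.\<close>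

lemma (in cdf_distribution) prob_survival_le:
  assumes atomless: "\<And>x. prob {x} = 0" and a: "0 \<le> a" "a \<le> 1"
  shows "prob {x. 1 - cdf M x \<le> a} = a"
proof -
  have inner: "prob {x. 1 - cdf M x \<le> u} = u" if u: "0 < u" "u < 1" for u
  proof -
    obtain t where pseudo: "1 - u \<le> cdf M x \<longleftrightarrow> t \<le> x" for x
    proof (rule that)
      show "1 - u \<le> cdf M x \<longleftrightarrow> I (1 - u) \<le> x" for x
        using u by (intro pseudoinverse) auto
    qed
    \<comment> \<open>The choice of \<open>t\<close> gives \<open>cdf M t\<close> at least
      \<open>1 - u\<close>. For the other inequality, the cdf stays below \<open>1 - u\<close> to
      the left of \<open>t\<close> and is continuous at \<open>t\<close>.\<close>
    have "cdf M x < 1 - u" if "x < t" for x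
      using pseudo[of x] that by auto
    then have "eventually (\<lambda>x. cdf M x \<le> 1 - u) (at_left t)"
      by (auto simp: eventually_at_filter less_imp_le)
    moreover have "(cdf M \<longlongrightarrow> cdf M t) (at_left t)"
      using isCont_cdf[of t] atomless by (auto simp: isCont_def intro: filterlim_mono at_le)
    ultimately have "cdf M t \<le> 1 - u"
      by (intro tendsto_upperbound) auto
    with pseudo[of t] have Ct: "cdf M t = 1 - u"
      by auto
    have "1 - cdf M x \<le> u \<longleftrightarrow> t \<le> x" for x
      using pseudo[of x] by linarith
    then have "{x. 1 - cdf M x \<le> u} = {t..}"
      by (simp only: atLeast_def)
    also have "{t..} = (space M - {..t}) \<union> {t}"
      by auto
    also have "prob \<dots> = prob (space M - {..t}) + prob {t}"
      by (rule finite_measure_Union) auto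
    also have "\<dots> = u"
      using Ct atomless by (subst prob_compl) (auto simp: cdf_def)
    finally show ?thesis .
  qed
  consider "a = 0" | "a = 1" | "0 < a" "a < 1"
    using a by linarith
  then show ?thesis
  proof cases
    case 1
    \<comment> \<open>The set for level 0 is contained in the set for every positive level; the
      minimum with \<open>1/2\<close> keeps that level below 1.\<close>
    have "prob {x. 1 - cdf M x \<le> 0} \<le> 0"
    proof (rule field_le_epsilon)
      fix e :: real assume "0 < e"
      then have e: "0 < min e (1/2)" "min e (1/2) < 1" by auto
      have "prob {x. 1 - cdf M x \<le> 0} \<le> prob {x. 1 - cdf M x \<le> min e (1/2)}"
        using e by (intro finite_measure_mono) auto
      also have "\<dots> \<le> 0 + e"
        using inner[OF e] by simp
      finally show "prob {x. 1 - cdf M x \<le> 0} \<le> 0 + e" .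
    qed
    then show ?thesis
      using 1 measure_nonneg[of M "{x. 1 - cdf M x \<le> 0}"] by (simp del: measure_nonneg)
  next
    case 2
    have "{x. 1 - cdf M x \<le> a} = space M"
      using cdf_nonneg 2 by auto
    then show ?thesis
      using prob_space 2 by simp
  qed (rule inner)
qed

section \<open>Binomial tails and the Beta distribution function\<close>

text \<open>The event splits into the disjoint events \<open>E S\<close> that \<open>S\<close> is
  exactly the set of successful indices. Independence makes the probability of \<open>E S\<close> a
  product depending only on \<open>card S\<close>, and sets of equal size are then counted.\<close>

lemma (in prob_space) prob_indep_at_least:
  assumes indep: "indep_vars (\<lambda>_. N) X I" and fin: "finite I" and B: "B \<in> sets N"
    and q: "\<And>i. i \<in> I \<Longrightarrow> prob (X i -` B \<inter> space M) = q"
  shows "prob {\<omega>\<in>space M. r \<le> card {i\<in>I. X i \<omega> \<in> B}} =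
         (\<Sum>k=r..card I. real (card I choose k) * q ^ k * (1 - q) ^ (card I - k))"
proof -
  have X: "X i \<in> measurable M N" if "i \<in> I" for i
    using indep that by (auto simp: indep_vars_def)
  define E where "E S = {\<omega>\<in>space M. {i\<in>I. X i \<omega> \<in> B} = S}" for S
  let ?C = "\<lambda>S i. if i \<in> S then B else space N - B"
  \<comment> \<open>Over an empty \<open>I\<close> the intersection would be the whole type instead
    of \<open>space M\<close>, hence the separate cases for \<open>I = {}\<close> below.\<close>
  have E_INT: "E S = (\<Inter>i\<in>I. X i -` ?C S i \<inter> space M)" if "S \<subseteq> I" "I \<noteq> {}" for S
  proof (intro equalityI subsetI)
    fix \<omega> assume "\<omega> \<in> E S"
    then show "\<omega> \<in> (\<Inter>i\<in>I. X i -` ?C S i \<inter> space M)"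
      using measurable_space[OF X] by (auto simp: E_def)
  next
    fix \<omega> assume *: "\<omega> \<in> (\<Inter>i\<in>I. X i -` ?C S i \<inter> space M)"
    have "X i \<omega> \<in> B \<longleftrightarrow> i \<in> S" if "i \<in> I" for i
    proof -
      have "\<omega> \<in> X i -` ?C S i \<inter> space M"
        using * that by blast
      then show ?thesis by (auto split: if_splits)
    qed
    moreover have "\<omega> \<in> space M"
      using * \<open>I \<noteq> {}\<close> by blast
    ultimately show "\<omega> \<in> E S"
      using \<open>S \<subseteq> I\<close> by (auto simp: E_def)
  qed
  have meas: "X i -` ?C S i \<inter> space M \<in> events" if "i \<in> I" for i S
    using X[OF that] B by (intro measurable_sets[of _ _ N]) auto
  have E_sets: "E S \<in> events" if "S \<subseteq> I" for S
  proof (cases "I = {}")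
    case False
    show ?thesis
      unfolding E_INT[OF that False] using False fin meas by (intro sets.finite_INT) auto
  qed (use that in \<open>simp add: E_def\<close>)
  have E_prob: "prob (E S) = q ^ card S * (1 - q) ^ (card I - card S)" if S: "S \<subseteq> I" for S
  proof (cases "I = {}")
    case False
    have compl: "prob (X i -` (space N - B) \<inter> space M) = 1 - q" if "i \<in> I" for i
    proof -
      have "X i -` (space N - B) \<inter> space M = space M - (X i -` B \<inter> space M)"
        using measurable_space[OF X[OF that]] by auto
      then show ?thesis
        using q[OF that] measurable_sets[OF X[OF that] B] by (simp add: prob_compl)
    qed
    have "prob (E S) = (\<Prod>i\<in>I. prob (X i -` ?C S i \<inter> space M))"
      unfolding E_INT[OF S False] using False fin B by (intro indep_varsD_finite[OF indep]) auto
    also have "\<dots> = (\<Prod>i\<in>I. if i \<in> S then q else 1 - q)"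
      by (intro prod.cong refl) (auto simp: q compl)
    also have "\<dots> = q ^ card S * (1 - q) ^ (card I - card S)"
    proof -
      have "I \<inter> {i. i \<in> S} = S" "I \<inter> - {i. i \<in> S} = I - S"
        using S by auto
      then show ?thesis
        using fin S by (simp add: prod.If_cases card_Diff_subset finite_subset)
    qed
    finally show ?thesis .
  qed (use S prob_space in \<open>simp add: E_def\<close>)
  let ?\<S> = "\<lambda>k. {S. S \<subseteq> I \<and> card S = k}"
  have "{\<omega>\<in>space M. r \<le> card {i\<in>I. X i \<omega> \<in> B}} = (\<Union>S\<in>{S. S \<subseteq> I \<and> r \<le> card S}. E S)"
    unfolding E_def by auto
  also have "prob \<dots> = (\<Sum>S | S \<subseteq> I \<and> r \<le> card S. prob (E S))"
    using fin E_sets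
    by (intro finite_measure_finite_Union) (auto simp: disjoint_family_on_def E_def)
  also have "{S. S \<subseteq> I \<and> r \<le> card S} = (\<Union>k\<in>{r..card I}. ?\<S> k)"
    using card_mono[OF fin] by auto
  also have "(\<Sum>S\<in>\<dots>. prob (E S)) = (\<Sum>k=r..card I. \<Sum>S\<in>?\<S> k. prob (E S))"
    using fin by (intro sum.UNION_disjoint) auto
  also have "\<dots> = (\<Sum>k=r..card I. real (card I choose k) * q ^ k * (1 - q) ^ (card I - k))"
  proof (intro sum.cong refl)
    fix k
    have "(\<Sum>S\<in>?\<S> k. prob (E S)) = (\<Sum>S\<in>?\<S> k. q ^ k * (1 - q) ^ (card I - k))"
      by (intro sum.cong refl) (auto simp: E_prob)
    then show "(\<Sum>S\<in>?\<S> k. prob (E S)) = real (card I choose k) * q ^ k * (1 - q) ^ (card I - k)"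
      using n_subsets[OF fin, of k] by simp
  qed
  finally show ?thesis .
qed

text \<open>Differentiating the binomial tail, all summands but one cancel in pairs; this is what
  turns the tail into a Beta distribution function.\<close>

lemma has_real_derivative_binomial_tail:
  fixes u :: real
  assumes "r \<le> n + 1"
  shows "((\<lambda>u. \<Sum>k=r..n. real (n choose k) * u ^ k * (1 - u) ^ (n - k)) has_real_derivative
           real r * real (n choose r) * u ^ (r - 1) * (1 - u) ^ (n - r)) (at u)"
  using assms
proof (induction r rule: inc_induct)
  case base
  then show ?case by (simp add: binomial_eq_0)
next
  case (step r)
  then have "r \<le> n" by simp
  \<comment> \<open>This equates the negative term in the derivative of the \<open>r\<close>-th
    summand with the derivative of the tail from \<open>Suc r\<close>, so that the two
    cancel.\<close>
  have absorb: "real (Suc r) * real (n choose Suc r) = real (n - r) * real (n choose r)"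
    unfolding of_nat_mult[symmetric] of_nat_eq_iff
    using binomial_absorb_comp[of n r] binomial_absorption[of r n] by simp
  have "((\<lambda>u. real (n choose r) * u ^ r * (1 - u) ^ (n - r) +
             (\<Sum>k=Suc r..n. real (n choose k) * u ^ k * (1 - u) ^ (n - k))) has_real_derivative
         (real r * real (n choose r) * u ^ (r - 1) * (1 - u) ^ (n - r)
           - real (n - r) * real (n choose r) * u ^ r * (1 - u) ^ (n - Suc r))
         + real (Suc r) * real (n choose Suc r) * u ^ (Suc r - 1) * (1 - u) ^ (n - Suc r)) (at u)"
    by (rule DERIV_add[OF _ step.IH])
       (auto intro!: derivative_eq_intros simp: algebra_simps)
  then show ?case
    using \<open>r \<le> n\<close> unfolding absorb by (simp add: sum.atLeast_Suc_atMost)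
qed

text \<open>Gamma values at positive integers are factorials. The lemma matches the normalising
  constant of the density with the coefficient in the derivative of the binomial tail.\<close>

lemma Beta_nat:
  assumes r: "r \<in> {1..n}"
  shows "1 / Beta (real r) (real (n + 1 - r)) = real r * real (n choose r)"
proof -
  obtain j where j: "r = Suc j" using r by (cases r) auto
  obtain m where m: "n = r + m" using r by (auto simp: le_iff_add)
  have "Beta (real r) (real (n + 1 - r)) = fact j * fact m / fact n"
    using Gamma_fact[of j, where 'a = real] Gamma_fact[of m, where 'a = real]
      Gamma_fact[of n, where 'a = real]
    by (simp add: Beta_def j m add_ac)
  moreover have "real (n choose r) = fact n / (fact r * fact m)"
    using m by (simp add: binomial_fact)
  moreover have "fact r = real r * fact j"
    by (simp add: j)
  moreover have "real r \<noteq> 0"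
    by (simp add: j)
  ultimately show ?thesis
    by (simp only:) (simp add: divide_simps)
qed

text \<open>Inside the unit interval the density is the derivative of the binomial tail, so the
  fundamental theorem of calculus applies. The tail vanishes at 0 since every summand has a factor
  \<open>0 ^ k\<close> with \<open>k\<close> at least \<open>r\<close>, hence positive.\<close>

lemma nn_integral_beta_density:
  assumes r: "r \<in> {1..n}" and a: "0 \<le> a" "a \<le> 1"
  shows "(\<integral>\<^sup>+x. ennreal (beta_density (real r) (real (n + 1 - r)) x) * indicator {..a} x \<partial>lborel)
         = ennreal (\<Sum>k=r..n. real (n choose k) * a ^ k * (1 - a) ^ (n - k))"
proof -
  let ?f = "\<lambda>u::real. real r * real (n choose r) * u ^ (r - 1) * (1 - u) ^ (n - r)"
  let ?H = "\<lambda>u::real. \<Sum>k=r..n. real (n choose k) * u ^ k * (1 - u) ^ (n - k)"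
  have dens: "beta_density (real r) (real (n + 1 - r)) x = ?f x" if "0 < x" "x < 1" for x
  proof -
    have "beta_density (real r) (real (n + 1 - r)) x =
        (1 / Beta (real r) (real (n + 1 - r))) * x powr (real r - 1) * (1 - x) powr (real (n + 1 - r) - 1)"
      using that by (simp add: beta_density_def)
    moreover have "x powr (real r - 1) = x ^ (r - 1)"
      using r that by (subst powr_realpow[symmetric]) (auto simp: of_nat_diff)
    moreover have "(1 - x) powr (real (n + 1 - r) - 1) = (1 - x) ^ (n - r)"
      using r that by (subst powr_realpow[symmetric]) (auto simp: of_nat_diff)
    ultimately show ?thesis
      unfolding Beta_nat[OF r] by (simp only:)
  qed
  \<comment> \<open>At 0 and 1 the density is 0 by definition, whereas the polynomial may be nonzero
    there (\<open>r = 1\<close> at 0, \<open>r = n\<close> at 1); the two agree only almost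
    everywhere.\<close>
  have "AE x in lborel. x \<notin> {0, 1::real}"
    by (intro AE_not_in) (auto intro: countable_imp_null_set_lborel)
  then have "AE x in lborel. ennreal (beta_density (real r) (real (n + 1 - r)) x) * indicator {..a} x
               = ennreal (?f x) * indicator {0..a} x"
  proof eventually_elim
    case (elim x)
    consider "x < 0" | "0 < x" "x < 1" | "x > 1"
      using elim by fastforce
    then show ?case
      using a dens[of x] by cases (auto simp: beta_density_def split: split_indicator)
  qed
  then have "(\<integral>\<^sup>+x. ennreal (beta_density (real r) (real (n + 1 - r)) x) * indicator {..a} x \<partial>lborel)
      = (\<integral>\<^sup>+x. ennreal (?f x) * indicator {0..a} x \<partial>lborel)"
    by (rule nn_integral_cong_AE)
  also have "\<dots> = ennreal (?H a - ?H 0)"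
  proof (rule nn_integral_FTC_Icc)
    show "(?H has_real_derivative ?f x) (at x)" for x
      using r by (intro has_real_derivative_binomial_tail) simp
  qed (use a in auto)
  also have "?H 0 = 0"
    using r by (intro sum.neutral) auto
  finally show ?thesis by simp
qed

lemma borel_measurable_beta_density [measurable]: "beta_density a b \<in> borel_measurable borel"
  unfolding beta_density_def by measurable

lemma beta_density_nonneg:
  assumes "0 < a" "0 < b"
  shows "0 \<le> beta_density a b x"
  using assms by (simp add: beta_density_def Beta_def Gamma_real_pos less_imp_le)

section \<open>The law of the coverage\<close>

text \<open>The depth is abstracted away here: \<open>C_le\<close> says that \<open>C\<close> is the
  \<open>r\<close>-th smallest of the independent uniforms \<open>U (X i)\<close>. It suffices to
  compare distribution functions.\<close>

lemma (in prob_space) distributed_beta_order_statistic: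
  fixes C :: "'a \<Rightarrow> real"
  assumes r: "r \<in> {1..n}"
    and C01: "\<And>\<omega>. \<omega> \<in> space M \<Longrightarrow> 0 \<le> C \<omega> \<and> C \<omega> \<le> 1"
    and indep: "indep_vars (\<lambda>_. N) X {1..n}" and U[measurable]: "U \<in> borel_measurable N"
    and unif: "\<And>i a. i \<in> {1..n} \<Longrightarrow> 0 \<le> a \<Longrightarrow> a \<le> 1 \<Longrightarrow> prob {\<omega>\<in>space M. U (X i \<omega>) \<le> a} = a"
    and C_le: "\<And>\<omega> a. \<omega> \<in> space M \<Longrightarrow> C \<omega> \<le> a \<longleftrightarrow> r \<le> card {i\<in>{1..n}. U (X i \<omega>) \<le> a}"
  shows "distributed M lborel C (beta_density (real r) (real (n + 1 - r)))"
proof (rule distributedI_borel_atMost)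
  let ?f = "beta_density (real r) (real (n + 1 - r))"
  let ?H = "\<lambda>u::real. \<Sum>k=r..n. real (n choose k) * u ^ k * (1 - u) ^ (n - k)"
  \<comment> \<open>The common distribution function: the binomial tail on the unit interval,
    continued by 0 to the left and by its value at 1 to the right.\<close>
  define g where "g a = (if a < 0 then 0 else ?H (min a 1))" for a
  have X[measurable]: "X i \<in> measurable M N" if "i \<in> {1..n}" for i
    using indep that by (auto simp: indep_vars_def)
  \<comment> \<open>Measurability of \<open>C\<close> is derived: by \<open>C_le\<close> its
    sublevel sets are events about a count of measurable conditions.\<close>
  have "{\<omega>\<in>space M. C \<omega> \<le> a} \<in> events" for a
  proof -
    have "{\<omega>\<in>space M. i \<in> {1..n} \<and> U (X i \<omega>) \<le> a} \<in> events" for i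
      by (cases "i \<in> {1..n}") simp_all
    then have [measurable]: "(\<lambda>\<omega>. card {i\<in>{1..n}. U (X i \<omega>) \<le> a}) \<in> measurable M (count_space UNIV)"
      by (intro measurable_card) simp
    have "{\<omega>\<in>space M. C \<omega> \<le> a} = {\<omega>\<in>space M. r \<le> card {i\<in>{1..n}. U (X i \<omega>) \<le> a}}"
      using C_le by blast
    then show ?thesis by simp
  qed
  then show "C \<in> borel_measurable M"
    by (simp add: borel_measurable_iff_le)
  show "AE x in lborel. 0 \<le> ?f x"
    using r by (intro AE_I2 beta_density_nonneg) auto
  show "(\<integral>\<^sup>+x. ?f x * indicator {..a} x \<partial>lborel) = ennreal (g a)" for a
  proof (cases "a < 0")
    case True
    then have "?f x * indicator {..a} x = 0" for x
      by (auto simp: beta_density_def indicator_def)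
    then show ?thesis
      using True by (simp only: g_def) simp
  next
    case False
    have "ennreal (?f x * indicator {..a} x) = ennreal (?f x) * indicator {..min a 1} x" for x
      by (auto simp: beta_density_def split: split_indicator)
    then show ?thesis
      using False nn_integral_beta_density[OF r, of "min a 1"] by (simp add: g_def)
  qed
  show "emeasure M {\<omega>\<in>space M. C \<omega> \<le> a} = ennreal (g a)" for a
  proof (cases "a < 0")
    case True
    then have "{\<omega>\<in>space M. C \<omega> \<le> a} = {}"
      using C01 by force
    then show ?thesis
      using True by (simp only: g_def) simp
  next
    case False
    define b where "b = min a 1"
    have b: "0 \<le> b" "b \<le> 1"
      using False by (auto simp: b_def)
    have "{\<omega>\<in>space M. C \<omega> \<le> a} = {\<omega>\<in>space M. C \<omega> \<le> b}"
      using C01 by (force simp: b_def)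
    also have "\<dots> = {\<omega>\<in>space M. r \<le> card {i\<in>{1..n}. X i \<omega> \<in> {y\<in>space N. U y \<le> b}}}"
    proof (intro Collect_cong conj_cong refl)
      fix \<omega> assume \<omega>: "\<omega> \<in> space M"
      have "X i \<omega> \<in> space N" if "i \<in> {1..n}" for i
        using measurable_space[OF X \<omega>] that by simp
      then have "{i\<in>{1..n}. X i \<omega> \<in> {y\<in>space N. U y \<le> b}} = {i\<in>{1..n}. U (X i \<omega>) \<le> b}"
        by auto
      then show "C \<omega> \<le> b \<longleftrightarrow> r \<le> card {i\<in>{1..n}. X i \<omega> \<in> {y\<in>space N. U y \<le> b}}"
        using C_le[OF \<omega>] by simp
    qed
    also have "prob \<dots> = ?H b"
    proof -
      have "prob (X i -` {y\<in>space N. U y \<le> b} \<inter> space M) = b" if i: "i \<in> {1..n}" for i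
      proof -
        have "X i -` {y\<in>space N. U y \<le> b} \<inter> space M = {\<omega>\<in>space M. U (X i \<omega>) \<le> b}"
          using measurable_space[OF X[OF i]] by auto
        then show ?thesis
          using unif[OF i b] by simp
      qed
      from prob_indep_at_least[OF indep _ _ this, of r] show ?thesis
        by simp
    qed
    finally show ?thesis
      using False by (simp add: emeasure_eq_measure g_def b_def)
  qed
qed simp

theorem theorem3p1:
  fixes D :: "(real^'p) measure \<Rightarrow> real^'p \<Rightarrow> real"
    and F :: "(real^'p) measure"
    and M :: "'a measure"
    and X :: "nat \<Rightarrow> 'a \<Rightarrow> real^'p"
    and n r :: nat
  assumes "CARD('p) \<ge> 2"
    and "data_depth D"
    and "prob_space F" and "sets F = sets borel"
    and "continuous_distribution F"
    and "D F \<in> borel_measurable borel"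
    and "continuous_distribution (distr F borel (D F))"
    and "prob_space M"
    and "prob_space.indep_vars M (\<lambda>_. borel) X {1..n}"
    and "\<forall>i\<in>{1..n}. distr M borel (X i) = F"
    and "r \<in> {1..n}"
  shows "(\<forall>\<omega>\<in>space M. tolerance_region (D F) n (\<lambda>i. X i \<omega>) r
            = {x. ereal (D F x) > depth_order_stat (D F) n (\<lambda>i. X i \<omega>) r})
       \<and> distributed M lborel
           (\<lambda>\<omega>. measure F (tolerance_region (D F) n (\<lambda>i. X i \<omega>) r))
           (beta_density (real r) (real (n + 1 - r)))"
proof -
  interpret F: prob_space F by fact
  interpret M: prob_space M by fact
  have sF: "space F = UNIV"
    using sets_eq_imp_space_eq[OF assms(4)] by simp
  have DF[measurable]: "D F \<in> borel_measurable F"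
    using assms(4,6) by (simp cong: measurable_cong_sets)
  let ?Z = "distr F borel (D F)"
  interpret Z: cdf_distribution ?Z
    unfolding cdf_distribution_def by (rule F.real_distribution_distr) (rule DF)
  let ?G = "\<lambda>t. 1 - cdf ?Z t"
  \<comment> \<open>This rests on the continuity of the law of the depth itself; an atomless
    \<open>F\<close> may still give positive mass to a level set of the depth.\<close>
  have Z_atomless: "measure ?Z {z} = 0" for z
    using assms(7) by (simp add: continuous_distribution_def measure_def)
  have G: "measure F {x. t < D F x} = ?G t" for t
  proof -
    have "measure F {x. t < D F x} = measure F (space F - D F -` {..t} \<inter> space F)"
      by (rule arg_cong[where f = "measure F"]) (auto simp: sF)
    also have "\<dots> = ?G t"
      by (subst F.prob_compl) (auto simp: cdf_def measure_distr)
    finally show ?thesis .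
  qed
  \<comment> \<open>Greater depth means smaller \<open>?G\<close>, so the condition that
    \<open>?G t\<close> is at most \<open>a\<close> is upward closed in \<open>t\<close>, as
    \<open>nth_rev_sort_iff_filter\<close> demands.\<close>
  have G_up: "?G t \<le> a" if "s \<le> t" "?G s \<le> a" for s t a
    using Z.cdf_nondecreasing[OF that(1)] that(2) by linarith
  have region: "tolerance_region (D F) n x r = {y. ereal (D F y) > depth_order_stat (D F) n x r}" for x
    using assms(11) by (rule tolerance_region_eq)
  have "distributed M lborel
           (\<lambda>\<omega>. measure F (tolerance_region (D F) n (\<lambda>i. X i \<omega>) r))
           (beta_density (real r) (real (n + 1 - r)))"
  proof (rule M.distributed_beta_order_statistic[OF assms(11) _ assms(9), where U = "\<lambda>x. ?G (D F x)"])
    show "0 \<le> measure F (tolerance_region (D F) n (\<lambda>i. X i \<omega>) r) \<and>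
          measure F (tolerance_region (D F) n (\<lambda>i. X i \<omega>) r) \<le> 1" for \<omega>
      by simp
    show U: "(\<lambda>x. ?G (D F x)) \<in> borel_measurable borel"
      using assms(6) by measurable
    show "M.prob {\<omega>\<in>space M. ?G (D F (X i \<omega>)) \<le> a} = a"
      if i: "i \<in> {1..n}" and a: "0 \<le> a" "a \<le> 1" for i a
    proof -
      have [measurable]: "X i \<in> borel_measurable M"
        using assms(9) i by (auto simp: M.indep_vars_def)
      have S: "{x. ?G (D F x) \<le> a} \<in> sets borel"
        using U by measurable
      \<comment> \<open>The event is transported from the sample space to \<open>F\<close> and then
        to the law of the depth on the line, where the integral transform applies.\<close>
      have "M.prob {\<omega>\<in>space M. ?G (D F (X i \<omega>)) \<le> a} = measure (distr M borel (X i)) {x. ?G (D F x) \<le> a}"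
        using S by (subst measure_distr) (auto intro!: arg_cong[where f = "measure M"])
      also have "\<dots> = measure F (D F -` {z. ?G z \<le> a} \<inter> space F)"
        using assms(10) i by (auto simp: sF intro!: arg_cong[where f = "measure F"])
      also have "\<dots> = measure ?Z {z. ?G z \<le> a}"
        by (subst measure_distr) auto
      also have "\<dots> = a"
        by (rule Z.prob_survival_le[OF Z_atomless a])
      finally show ?thesis .
    qed
    show "measure F (tolerance_region (D F) n (\<lambda>i. X i \<omega>) r) \<le> a \<longleftrightarrow>
        r \<le> card {i\<in>{1..n}. ?G (D F (X i \<omega>)) \<le> a}" for \<omega> a
    proof -
      let ?xs = "map (\<lambda>j. D F (X j \<omega>)) [1..<n+1]"
      \<comment> \<open>Since \<open>r\<close> is between 1 and \<open>n\<close>, the threshold is a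
        genuine list entry, at position \<open>r - 1\<close>, and the coverage is \<open>?G\<close>
        of it.\<close>
      have "measure F (tolerance_region (D F) n (\<lambda>i. X i \<omega>) r) = ?G (rev (sort ?xs) ! (r - 1))"
        using assms(11) unfolding region by (simp add: depth_order_stat_def G del: upt_Suc)
      also have "\<dots> \<le> a \<longleftrightarrow> r - 1 < length (filter (\<lambda>z. ?G z \<le> a) ?xs)"
        using assms(11) by (intro nth_rev_sort_iff_filter) (auto intro: G_up)
      also have "\<dots> \<longleftrightarrow> r \<le> card {i\<in>{1..n}. ?G (D F (X i \<omega>)) \<le> a}"
        using assms(11) unfolding filter_map_upt_length by auto
      finally show ?thesis .
    qed
  qed
  with region show ?thesis
    by blast
qed

end
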